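(* Let $\lambda>0$, $\beta\in(0,1]$, and $\Phi\in(N)^{-1}_{\pi_{\lambda,\beta}}$. Let $L$ be an analytic function in a neighborhood of $z_0=\mathbb{E}_{\pi_{\lambda,\beta}}(\Phi)\in\mathbb{C}$. Then $L^{\Diamond}(\Phi)$, defined by $$L^{\Diamond}(\Phi):=S_{\pi_{\lambda,\beta}}^{-1}\big(L(S_{\pi_{\lambda,\beta}}\Phi)\big),$$ is an element of $(N)^{-1}_{\pi_{\lambda,\beta}}$.
   Context: $\mathbb{N}_0=\{0,1,2,\dots\}$. The Mittag-Leffler function is $E_\beta(z)=\sum_{n=0}^\infty \frac{z^n}{\Gamma(\beta n+1)}$. The fractional Poisson measure $\pi_{\lambda,\beta}$ is the probability measure on $\mathbb{R}$ concentrated on $\mathbb{N}_0$ with $\pi_{\lambda,\beta}(\{k\})=\frac{\lambda^k}{k!}E_\beta^{(k)}(-\lambda)$. The Wick exponential is $\mathrm{e}_{\pi_{\lambda,\beta}}(z;x)=\frac{e^{zx}}{E_\beta(\lambda(e^z-1))}$. The generalized Appell polynomials $C_n^{\lambda,\beta}$ are defined by $\mathrm{e}_{\pi_{\lambda,\beta}}(\log(1+z);x)=\sum_{n=0}^\infty\frac{z^n}{n!}C_n^{\lambda,\beta}(x)$ for $z$ near $0$; equivalently $\mathrm{e}_{\pi_{\lambda,\beta}}(z;\cdot)=\sum_{n=0}^\infty\frac{(e^z-1)^n}{n!}C_n^{\lambda,\beta}$ for $z$ near $0$. For $q\in\mathbb{N}_0$, $(H)^1_{q,\pi_{\lambda,\beta}}$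 is the Hilbert space of series $\varphi=\sum_n\varphi_nC_n^{\lambda,\beta}$ with $\sum_{n}(n!)^22^{nq}|\varphi_n|^2<\infty$. The generalized dual Appell system $(Q_n^{\pi_{\lambda,\beta}})_{n\in\mathbb{N}_0}$ consists of the functionals on polynomials given by $\langle\!\langle\varphi,Q_n^{\pi_{\lambda,\beta}}\rangle\!\rangle_{\pi_{\lambda,\beta}}=\int_{\mathbb{R}}(\Delta^n\varphi)(x)\,\mathrm{d}\pi_{\lambda,\beta}(x)$, $(\Delta\varphi)(x)=\varphi(x+1)-\varphi(x)$; they satisfy $\langle\!\langle C_n^{\lambda,\beta},Q_m^{\pi_{\lambda,\beta}}\rangle\!\rangle_{\pi_{\lambda,\beta}}=n!\delta_{n,m}$. The dual of $(H)^1_{q,\pi_{\lambda,\beta}}$ is $(H)^{-1}_{-q,\pi_{\lambda,\beta}}$, the Hilbert space of series $\Phi=\sum_n\Phi_nQ_n^{\pi_{\lambda,\beta}}$ with $\sum_n2^{-nq}|\Phi_n|^2<\infty$, with pairing $\langle\!\langle\varphi,\Phi\rangle\!\rangle_{\pi_{\lambda,\beta}}=\sum_nn!\,\varphi_n\Phi_n$, and $(N)^{-1}_{\pi_{\lambda,\beta}}=\bigcup_{q\in\mathbb{N}_0}(H)^{-1}_{-q,\pi_{\lambda,\beta}}$. The $S_{\pi_{\lambda,\beta}}$-transform of $\Phi\in(N)^{-1}_{\pi_{\lambda,\beta}}$ is $(S_{\pi_{\lambda,\beta}}\Phi)(z)=\langle\!\langle\mathrm{e}_{\pi_{\lambda,\beta}}(z;\cdot),\Phi\rangle\!\rangle_{\pi_{\lambda,\beta}}$,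 defined for $z$ in a neighborhood of $0$ depending on $\Phi$; $S_{\pi_{\lambda,\beta}}$ is a bijection from $(N)^{-1}_{\pi_{\lambda,\beta}}$ onto the space $\mathrm{Hol}_0(\mathbb{C})$ of (germs of) holomorphic functions in a neighborhood of $0$. The expectation of $\Phi\in(N)^{-1}_{\pi_{\lambda,\beta}}$ is $\mathbb{E}_{\pi_{\lambda,\beta}}(\Phi)=\langle\!\langle\mathbf{1},\Phi\rangle\!\rangle_{\pi_{\lambda,\beta}}=(S_{\pi_{\lambda,\beta}}\Phi)(0)$. *)

theory Defs
  imports "HOL-Complex_Analysis.Complex_Analysis"
begin

definition mittag_leffler :: "real \<Rightarrow> complex \<Rightarrow> complex" where
  "mittag_leffler \<beta> z = (\<Sum>n. z ^ n / of_real (Gamma (\<beta> * real n + 1)))"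

text \<open>The derivatives below are real. They are also nonnegative for \<open>0 < \<beta> \<le> 1\<close> and
  \<open>lam > 0\<close>, because \<open>x \<mapsto> mittag_leffler \<beta> (- x)\<close> is completely monotone on
  \<open>[0, \<infinity>)\<close>, so neither \<open>Re\<close> nor \<open>ennreal\<close> loses anything.\<close>

definition fractional_poisson_weight :: "real \<Rightarrow> real \<Rightarrow> nat \<Rightarrow> real" where
  "fractional_poisson_weight lam \<beta> k =
     lam ^ k / fact k * Re ((deriv ^^ k) (mittag_leffler \<beta>) (- of_real lam))"

definition fractional_poisson :: "real \<Rightarrow> real \<Rightarrow> real measure" where
  "fractional_poisson lam \<beta> =
     distr (density (count_space UNIV) (\<lambda>k. ennreal (fractional_poisson_weight lam \<beta> k)))
       borel real"

definition wick_exp :: "real \<Rightarrow> real \<Rightarrow> complex \<Rightarrow> real \<Rightarrow> complex" where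
  "wick_exp lam \<beta> z x =
     exp (z * of_real x) / mittag_leffler \<beta> (of_real lam * (exp z - 1))"

text \<open>The generating function \<open>wick_exp (log (1 + z)) x = (\<Sum>n. z ^ n / n! * C n x)\<close>,
  read as a Taylor expansion at \<open>z = 0\<close>.\<close>

definition appell_C :: "real \<Rightarrow> real \<Rightarrow> nat \<Rightarrow> real \<Rightarrow> complex" where
  "appell_C lam \<beta> n x = (deriv ^^ n) (\<lambda>z. wick_exp lam \<beta> (Ln (1 + z)) x) 0"

text \<open>The space \<open>(H)\<^sup>1\<^sub>q\<close>; the sequence \<open>a\<close> stands for the series
  \<open>\<Sum>n. a n * C n\<close>.\<close>

definition test_space :: "nat \<Rightarrow> (nat \<Rightarrow> complex) set" where
  "test_space q = {a. summable (\<lambda>n. (fact n)\<^sup>2 * 2 ^ (n * q) * (norm (a n))\<^sup>2)}"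

text \<open>For small \<open>q\<close> the series in \<open>(H)\<^sup>1\<^sub>q\<close> may diverge pointwise (for instance when the
  Mittag-Leffler function has zeros close to \<open>0\<close>), and then they are only formal series. For all large \<open>q\<close>
  they converge absolutely at every point, and different sequences give different functions.
  Only for such \<open>q\<close> are functions on the real line identified with elements of
  \<open>(H)\<^sup>1\<^sub>q\<close>. The spaces \<open>(H)\<^sup>1\<^sub>q\<close> decrease in \<open>q\<close> while their duals
  increase, so nothing is lost in the union of the duals.\<close>

definition pointwise_convergent :: "real \<Rightarrow> real \<Rightarrow> nat \<Rightarrow> bool" where
  "pointwise_convergent lam \<beta> q \<longleftrightarrow>
     (\<forall>a\<in>test_space q. \<forall>x. summable (\<lambda>n. norm (a n * appell_C lam \<beta> n x)))"

definition test_coeff :: "real \<Rightarrow> real \<Rightarrow> (real \<Rightarrow> complex) \<Rightarrow> nat \<Rightarrow> complex" where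
  "test_coeff lam \<beta> \<phi> =
     (THE a. (\<exists>q. pointwise_convergent lam \<beta> q \<and> a \<in> test_space q) \<and>
             (\<forall>x. (\<lambda>n. a n * appell_C lam \<beta> n x) sums \<phi> x))"

definition forward_diff :: "(real \<Rightarrow> complex) \<Rightarrow> real \<Rightarrow> complex" where
  "forward_diff \<phi> x = \<phi> (x + 1) - \<phi> x"

definition appell_Q :: "real \<Rightarrow> real \<Rightarrow> nat \<Rightarrow> complex poly \<Rightarrow> complex" where
  "appell_Q lam \<beta> n p =
     (LINT x|fractional_poisson lam \<beta>. (forward_diff ^^ n) (\<lambda>y. poly p (of_real y)) x)"

text \<open>Generalized functions are functionals on polynomials. The sum below is finite for
  every \<open>p\<close>, since \<open>appell_Q lam \<beta> n p = 0\<close> for \<open>n > degree p\<close>.\<close>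

definition dual_series :: "real \<Rightarrow> real \<Rightarrow> (nat \<Rightarrow> complex) \<Rightarrow> complex poly \<Rightarrow> complex" where
  "dual_series lam \<beta> c = (\<lambda>p. \<Sum>n. c n * appell_Q lam \<beta> n p)"

definition dual_coeff :: "real \<Rightarrow> real \<Rightarrow> (complex poly \<Rightarrow> complex) \<Rightarrow> nat \<Rightarrow> complex" where
  "dual_coeff lam \<beta> \<Phi> = (THE c. \<Phi> = dual_series lam \<beta> c)"

text \<open>The spaces \<open>(H)\<^sup>-\<^sup>1\<^sub>-\<^sub>q\<close> and their union \<open>(N)\<^sup>-\<^sup>1\<close>.\<close>

definition dual_space :: "real \<Rightarrow> real \<Rightarrow> nat \<Rightarrow> (complex poly \<Rightarrow> complex) set" where
  "dual_space lam \<beta> q =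
     {dual_series lam \<beta> c |c. summable (\<lambda>n. (norm (c n))\<^sup>2 / 2 ^ (n * q))}"

definition distributions :: "real \<Rightarrow> real \<Rightarrow> (complex poly \<Rightarrow> complex) set" where
  "distributions lam \<beta> = (\<Union>q. dual_space lam \<beta> q)"

definition dual_pairing ::
  "real \<Rightarrow> real \<Rightarrow> (real \<Rightarrow> complex) \<Rightarrow> (complex poly \<Rightarrow> complex) \<Rightarrow> complex" where
  "dual_pairing lam \<beta> \<phi> \<Phi> =
     (\<Sum>n. fact n * test_coeff lam \<beta> \<phi> n * dual_coeff lam \<beta> \<Phi> n)"

definition wick_expectation :: "real \<Rightarrow> real \<Rightarrow> (complex poly \<Rightarrow> complex) \<Rightarrow> complex" where
  "wick_expectation lam \<beta> \<Phi> = dual_pairing lam \<beta> (\<lambda>_. 1) \<Phi>"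

text \<open>Meaningful only for \<open>z\<close> in a neighbourhood of \<open>0\<close> depending on \<open>\<Phi>\<close>; elsewhere the
  value is arbitrary. Hence \<open>S\<close> as a map takes values in germs at \<open>0\<close>.\<close>

definition S_transform ::
  "real \<Rightarrow> real \<Rightarrow> (complex poly \<Rightarrow> complex) \<Rightarrow> complex \<Rightarrow> complex" where
  "S_transform lam \<beta> \<Phi> z = dual_pairing lam \<beta> (wick_exp lam \<beta> z) \<Phi>"

definition germ0 :: "(complex \<Rightarrow> complex) \<Rightarrow> (complex \<Rightarrow> complex) set" where
  "germ0 f = {g. \<forall>\<^sub>F z in nhds 0. g z = f z}"

definition S_map ::
  "real \<Rightarrow> real \<Rightarrow> (complex poly \<Rightarrow> complex) \<Rightarrow> (complex \<Rightarrow> complex) set" where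
  "S_map lam \<beta> \<Phi> = germ0 (S_transform lam \<beta> \<Phi>)"

definition S_inverse ::
  "real \<Rightarrow> real \<Rightarrow> (complex \<Rightarrow> complex) set \<Rightarrow> complex poly \<Rightarrow> complex" where
  "S_inverse lam \<beta> = the_inv_into (distributions lam \<beta>) (S_map lam \<beta>)"

definition wick_apply ::
  "real \<Rightarrow> real \<Rightarrow> (complex \<Rightarrow> complex) \<Rightarrow> (complex poly \<Rightarrow> complex) \<Rightarrow> complex poly \<Rightarrow> complex"
  where
  "wick_apply lam \<beta> L \<Phi> = S_inverse lam \<beta> (germ0 (\<lambda>z. L (S_transform lam \<beta> \<Phi> z)))"

end

theory Submission
  imports Defs
begin

text \<open>On generalized functions with coefficients \<open>c n\<close> the transform \<open>S\<close> is the power series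
  \<open>\<Sum>n. c n * w ^ n\<close> in \<open>w = exp z - 1\<close>, and the growth condition defining \<open>distributions\<close> says
  exactly that this series has positive radius of convergence. Since \<open>w\<close> is a local coordinate at
  \<open>0\<close>, \<open>S\<close> is a bijection onto germs, and composing with \<open>L\<close> preserves analyticity.
  Coefficients are unique: for \<open>dual_coeff\<close> because the total mass of \<open>fractional_poisson\<close>
  is positive (the weights sum to \<open>1\<close> absolutely, so their positive parts have finite positive
  sum), for \<open>test_coeff\<close> by a deconvolution with the entire Mittag-Leffler function.\<close>

section \<open>The Mittag-Leffler function and the mass of the fractional Poisson measure\<close>

text \<open>On \<open>{R..}\<close> the integrand of \<open>Gamma (s + 1)\<close> dominates
  \<open>R powr s * exp (- t)\<close>, whose integral is the left side. As \<open>R\<close> is free,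
  \<open>Gamma\<close> outgrows every geometric sequence.\<close>

lemma powr_mult_exp_le_Gamma:
  fixes R s :: real
  assumes "R > 0" "s \<ge> 0"
  shows "R powr s * exp (- R) \<le> Gamma (s + 1)"
proof -
  have tail: "((\<lambda>t. R powr s * exp (- t)) has_integral R powr s * exp (- R)) {R..}"
    using has_integral_mult_right[OF has_integral_exp_minus_to_infinity[of 1 R]] by simp
  have full: "((\<lambda>t. if t \<in> {0..} then t powr s / exp t else 0) has_integral Gamma (s + 1)) UNIV"
    using Gamma_integral_real[of "s + 1"] assms
      has_integral_restrict_UNIV[of "{0..}" "\<lambda>t. t powr s / exp t" "Gamma (s + 1)"] by simp
  have tail': "((\<lambda>t. if t \<in> {R..} then R powr s * exp (- t) else 0) has_integral R powr s * exp (- R)) UNIV"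
    using tail
      has_integral_restrict_UNIV[of "{R..}" "\<lambda>t. R powr s * exp (- t)"] by simp
  show ?thesis
  proof (rule has_integral_le[OF tail' full])
    fix t :: real
    show "(if t \<in> {R..} then R powr s * exp (- t) else 0) \<le> (if t \<in> {0..} then t powr s / exp t else 0)"
      using assms by (auto simp: exp_minus divide_simps intro: powr_mono2)
  qed
qed

definition mittag_leffler_fps :: "real \<Rightarrow> complex fps" where
  "mittag_leffler_fps \<beta> = Abs_fps (\<lambda>n. 1 / of_real (Gamma (\<beta> * real n + 1)))"

lemma fps_conv_radius_mittag_leffler [simp]:
  assumes "0 < \<beta>"
  shows "fps_conv_radius (mittag_leffler_fps \<beta>) = \<infinity>"
  unfolding fps_conv_radius_def
proof (rule conv_radius_inftyI'')
  fix z :: complex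
  \<comment> \<open>Here \<open>R powr \<beta> = 2 * (norm z + 1)\<close>, so the bound on
    \<open>Gamma\<close> leaves terms of size at most \<open>exp R * (1 / 2) ^ n\<close>; the
    \<open>+ 1\<close> keeps the base positive at \<open>z = 0\<close>.\<close>
  define R where "R = (2 * (norm z + 1)) powr (1 / \<beta>)"
  have R: "R > 0" unfolding R_def by (smt (verit) norm_ge_zero powr_gt_zero)
  have Rn: "R powr (\<beta> * real n) = (2 * (norm z + 1)) ^ n" for n
    using assms unfolding R_def powr_powr
    by (subst powr_realpow[symmetric]) (auto simp: add_nonneg_pos)
  show "summable (\<lambda>n. fps_nth (mittag_leffler_fps \<beta>) n * z ^ n)"
  proof (rule summable_comparison_test')
    show "summable (\<lambda>n. exp R * (1 / 2) ^ n)"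
      by (intro summable_mult summable_geometric) auto
    fix n :: nat
    have G: "(2 * (norm z + 1)) ^ n * exp (- R) \<le> Gamma (\<beta> * real n + 1)"
      using powr_mult_exp_le_Gamma[OF R, of "\<beta> * real n"] assms by (simp add: Rn)
    have pos: "(2 * (norm z + 1)) ^ n * exp (- R) > 0"
      by (simp add: add_nonneg_pos)
    have "norm (fps_nth (mittag_leffler_fps \<beta>) n * z ^ n) = norm z ^ n / Gamma (\<beta> * real n + 1)"
      using G pos by (simp add: mittag_leffler_fps_def norm_mult norm_divide norm_power)
    also have "\<dots> \<le> (norm z + 1) ^ n / ((2 * (norm z + 1)) ^ n * exp (- R))"
      using G pos by (intro frac_le power_mono) auto
    also have "\<dots> = exp R * (1 / 2) ^ n"
    proof -
      have "c ^ n / ((2 * c) ^ n * exp (- R)) = exp R * (1 / 2) ^ n" if "c > 0" for c :: real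
        using that by (simp add: power_mult_distrib power_one_over exp_minus divide_simps)
      from this[of "norm z + 1"] show ?thesis using norm_ge_zero[of z] by linarith
    qed
    finally show "norm (fps_nth (mittag_leffler_fps \<beta>) n * z ^ n) \<le> exp R * (1 / 2) ^ n" .
  qed
qed

lemma mittag_leffler_eq_eval_fps: "mittag_leffler \<beta> = eval_fps (mittag_leffler_fps \<beta>)"
  by (auto simp: mittag_leffler_def eval_fps_def mittag_leffler_fps_def)

lemma mittag_leffler_holomorphic [holomorphic_intros]:
  assumes "0 < \<beta>" "f holomorphic_on A"
  shows "(\<lambda>z. mittag_leffler \<beta> (f z)) holomorphic_on A"
proof -
  have "mittag_leffler \<beta> holomorphic_on UNIV"
    unfolding mittag_leffler_eq_eval_fps using assms(1) by (intro holomorphic_on_eval_fps) auto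
  then show ?thesis
    using holomorphic_on_compose_gen[OF assms(2), of "mittag_leffler \<beta>" UNIV] by (simp add: o_def)
qed

lemma mittag_leffler_0 [simp]: "mittag_leffler \<beta> 0 = 1"
  by (simp add: mittag_leffler_eq_eval_fps eval_fps_at_0 mittag_leffler_fps_def)

text \<open>The weights are the real parts of the terms of the Taylor series of
  \<open>mittag_leffler \<beta>\<close> about \<open>- lam\<close>, evaluated at \<open>0\<close>,
  where the function is \<open>1\<close>. Convergence at increment \<open>lam + 1\<close> makes it
  absolute at increment \<open>lam\<close>.\<close>

lemma fractional_poisson_weight_sums:
  assumes "lam > 0" "0 < \<beta>"
  shows "fractional_poisson_weight lam \<beta> sums 1"
    and "summable (\<lambda>k. \<bar>fractional_poisson_weight lam \<beta> k\<bar>)"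
proof -
  define t where "t k = (deriv ^^ k) (mittag_leffler \<beta>) (- of_real lam) / fact k" for k
  have taylor: "(\<lambda>k. t k * w ^ k) sums mittag_leffler \<beta> (w - of_real lam)" for w
    using holomorphic_power_series[of "mittag_leffler \<beta>" "- of_real lam" "norm w + 1" "w - of_real lam"]
      mittag_leffler_holomorphic[OF assms(2), of "\<lambda>z. z"]
    by (auto simp: t_def dist_norm)
  have weight: "fractional_poisson_weight lam \<beta> k = Re (t k * of_real lam ^ k)" for k
  proof -
    have "t k * of_real lam ^ k = of_real (lam ^ k / fact k) * (deriv ^^ k) (mittag_leffler \<beta>) (- of_real lam)"
      by (simp add: t_def)
    then show ?thesis
      unfolding fractional_poisson_weight_def by (metis Re_complex_of_real Im_complex_of_real mult_zero_left diff_zero times_complex.sel(1))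
  qed
  show "fractional_poisson_weight lam \<beta> sums 1"
    using sums_Re[OF taylor[of "of_real lam"]] unfolding weight by simp
  have "summable (\<lambda>k. norm (t k * of_real lam ^ k))"
    by (rule powser_insidea[of t "of_real (lam + 1)"])
      (use taylor[of "of_real (lam + 1)"] assms in \<open>auto simp: sums_iff\<close>)
  then show "summable (\<lambda>k. \<bar>fractional_poisson_weight lam \<beta> k\<bar>)"
    by (rule summable_comparison_test'[where N = 0]) (simp only: weight real_norm_def abs_idempotent, rule abs_Re_le_cmod)
qed

text \<open>\<open>ennreal\<close> sends negative weights to \<open>0\<close> and
  \<open>measure\<close> sends infinite mass to \<open>0\<close>, so finiteness and nonvanishing
  both matter. The first follows from absolute summability, the second because weights that are all
  \<open>\<le> 0\<close> cannot sum to \<open>1\<close>.\<close>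

lemma measure_fractional_poisson_pos:
  assumes "lam > 0" "0 < \<beta>"
  shows "measure (fractional_poisson lam \<beta>) UNIV > 0"
proof -
  let ?w = "fractional_poisson_weight lam \<beta>"
  note w = fractional_poisson_weight_sums[OF assms]
  have em: "emeasure (fractional_poisson lam \<beta>) UNIV = (\<Sum>k. ennreal (?w k))"
    by (simp add: fractional_poisson_def emeasure_distr emeasure_density nn_integral_count_space_nat)
  have "(\<Sum>k. ennreal (?w k)) \<le> (\<Sum>k. ennreal \<bar>?w k\<bar>)"
    by (intro suminf_le ennreal_leI) auto
  also have "\<dots> = ennreal (\<Sum>k. \<bar>?w k\<bar>)"
    using w(2) by (intro suminf_ennreal2) auto
  finally have fin: "(\<Sum>k. ennreal (?w k)) < top"
    by (rule le_less_trans) simp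
  have "(\<Sum>k. ennreal (?w k)) \<noteq> 0"
  proof
    assume "(\<Sum>k. ennreal (?w k)) = 0"
    then have "?w k \<le> 0" for k
      using suminf_eq_zero_iff[of "\<lambda>k. ennreal (?w k)"] by (simp add: ennreal_eq_0_iff)
    then have "(1::real) \<le> 0"
      using w(1) by (intro sums_le[OF _ w(1) sums_zero]) auto
    then show False by simp
  qed
  with fin show ?thesis
    by (simp add: measure_def em enn2real_positive_iff zero_less_iff_neq_zero)
qed

section \<open>Coefficients of generalized functions\<close>

text \<open>Falling factorials make the functionals \<open>appell_Q\<close> triangular, since
  \<open>forward_diff\<close> lowers their degree by one.\<close>

definition falling_poly :: "nat \<Rightarrow> complex poly" where
  "falling_poly d = (\<Prod>i<d. [:- of_nat i, 1:])"

lemma poly_falling_poly: "poly (falling_poly d) x = (\<Prod>i<d. x - of_nat i)"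
  by (simp add: falling_poly_def poly_prod)

text \<open>The discrete power rule. The scalar \<open>c\<close> lets it apply to its own output;
  for \<open>d = 0\<close> the truncated \<open>d - 1\<close> is harmless because of the factor
  \<open>of_nat d\<close>.\<close>

lemma forward_diff_falling_poly:
  "forward_diff (\<lambda>y. c * poly (falling_poly d) (of_real y)) =
     (\<lambda>y. of_nat d * c * poly (falling_poly (d - 1)) (of_real y))"
proof (cases d)
  case (Suc e)
  have A: "poly (falling_poly (Suc e)) (x + 1) = (x + 1) * poly (falling_poly e) x" for x
    unfolding poly_falling_poly prod.lessThan_Suc_shift by simp
  have B: "poly (falling_poly (Suc e)) x = poly (falling_poly e) x * (x - of_nat e)" for x
    by (simp add: poly_falling_poly)
  have "poly (falling_poly (Suc e)) (x + 1) - poly (falling_poly (Suc e)) x =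
      of_nat (Suc e) * poly (falling_poly e) x" for x
    unfolding A B[of x] by (simp add: algebra_simps)
  then show ?thesis
    by (simp only: Suc forward_diff_def of_real_add of_real_1 diff_Suc_1 fun_eq_iff
        right_diff_distrib[symmetric]) (simp add: mult_ac)
qed (auto simp: forward_diff_def falling_poly_def)

text \<open>Truncated subtraction puts a factor \<open>0\<close> into the product as soon as
  \<open>n > d\<close>; for \<open>n = d\<close> the product is \<open>fact d\<close>.\<close>

lemma forward_diff_funpow_falling_poly:
  "(forward_diff ^^ n) (\<lambda>y. poly (falling_poly d) (of_real y)) =
     (\<lambda>y. (\<Prod>i<n. of_nat (d - i)) * poly (falling_poly (d - n)) (of_real y))"
proof (induction n)
  case (Suc n)
  show ?case
    by (simp add: Suc.IH forward_diff_falling_poly) (simp add: mult_ac)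
qed simp

lemma appell_Q_falling_poly_eq_0:
  assumes "d < n"
  shows "appell_Q lam \<beta> n (falling_poly d) = 0"
proof -
  have "(\<Prod>i<n. of_nat (d - i) :: complex) = 0"
    using assms by (intro prod_zero) auto
  then show ?thesis
    unfolding appell_Q_def forward_diff_funpow_falling_poly by simp
qed

text \<open>The \<open>d\<close>-th difference is the constant \<open>fact d\<close>, so the
  integral is \<open>fact d\<close> times the positive total mass.\<close>

lemma appell_Q_falling_poly_self:
  assumes "lam > 0" "0 < \<beta>"
  shows "appell_Q lam \<beta> d (falling_poly d) \<noteq> 0"
proof -
  have "space (fractional_poisson lam \<beta>) = UNIV"
    by (simp add: fractional_poisson_def)
  then show ?thesis
    unfolding appell_Q_def forward_diff_funpow_falling_poly
    using measure_fractional_poisson_pos[OF assms]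
    by (auto simp: falling_poly_def scaleR_conv_of_real)
qed

text \<open>Evaluation at \<open>falling_poly d\<close> cuts the series off at \<open>n = d\<close>,
  so the coefficients solve a triangular system with nonzero diagonal. This justifies the
  \<open>THE\<close> in \<open>dual_coeff\<close>.\<close>

lemma dual_series_inject:
  assumes "lam > 0" "0 < \<beta>" and eq: "dual_series lam \<beta> c = dual_series lam \<beta> c'"
  shows "c = c'"
proof
  fix d
  have ds: "dual_series lam \<beta> c (falling_poly d) =
      (\<Sum>n\<le>d. c n * appell_Q lam \<beta> n (falling_poly d))" for c d
    unfolding dual_series_def by (rule suminf_finite) (auto simp: appell_Q_falling_poly_eq_0)
  show "c d = c' d"
  proof (induction d rule: less_induct)
    case (less d)
    have "(\<Sum>n\<le>d. c n * appell_Q lam \<beta> n (falling_poly d)) =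
        (\<Sum>n\<le>d. c' n * appell_Q lam \<beta> n (falling_poly d))"
      using fun_cong[OF eq, of "falling_poly d"] by (simp add: ds)
    moreover have "(\<Sum>n<d. c n * appell_Q lam \<beta> n (falling_poly d)) =
        (\<Sum>n<d. c' n * appell_Q lam \<beta> n (falling_poly d))"
      using less by (intro sum.cong) auto
    ultimately show ?case
      using appell_Q_falling_poly_self[OF assms(1,2), of d]
      by (simp add: atMost_Suc flip: lessThan_Suc_atMost)
  qed
qed

lemma dual_coeff_dual_series:
  assumes "lam > 0" "0 < \<beta>"
  shows "dual_coeff lam \<beta> (dual_series lam \<beta> c) = c"
  unfolding dual_coeff_def using dual_series_inject[OF assms] by (intro the_equality) auto

text \<open>Both sides amount to a geometric bound on the coefficients.\<close>

lemma fps_conv_radius_pos_iff: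
  fixes F :: "complex fps"
  shows "fps_conv_radius F > 0 \<longleftrightarrow>
    (\<exists>q. summable (\<lambda>n. (norm (fps_nth F n))\<^sup>2 / 2 ^ (n * q)))"
proof
  assume "fps_conv_radius F > 0"
  then obtain r where r: "0 < r" "ereal r < fps_conv_radius F"
    by (metis ereal_dense2 ereal_less(2))
  \<comment> \<open>This makes \<open>r\<^sup>2 * 2 ^ q\<close> exceed \<open>2\<close>, which turns
    boundedness of the terms into domination with ratio \<open>1 / 2\<close>.\<close>
  obtain q where q: "2 / r\<^sup>2 < 2 ^ q"
    using real_arch_pow[of 2 "2 / r\<^sup>2"] by auto
  have "summable (\<lambda>n. fps_nth F n * of_real r ^ n)"
    by (rule summable_fps) (use r in auto)
  then have "Bseq (\<lambda>n. fps_nth F n * of_real r ^ n)"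
    by (intro convergent_imp_Bseq convergentI[of _ 0] summable_LIMSEQ_zero)
  then obtain K where K: "norm (fps_nth F n) * r ^ n \<le> K" for n
    using r(1) by (auto simp: Bseq_def norm_mult norm_power)
  have "summable (\<lambda>n. (norm (fps_nth F n))\<^sup>2 / 2 ^ (n * q))"
  proof (rule summable_comparison_test')
    show "summable (\<lambda>n. K\<^sup>2 * (1 / 2) ^ n)"
      by (intro summable_mult summable_geometric) auto
    fix n :: nat
    have "2 \<le> r\<^sup>2 * 2 ^ q"
      using q r by (simp add: field_simps)
    then have "2 ^ n \<le> (r\<^sup>2 * 2 ^ q) ^ n"
      by (rule power_mono) simp
    then have "(norm (fps_nth F n))\<^sup>2 / 2 ^ (n * q) \<le> (norm (fps_nth F n))\<^sup>2 / 2 ^ (n * q) * ((r\<^sup>2 * 2 ^ q) ^ n / 2 ^ n)"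
      using mult_left_mono[of 1 "(r\<^sup>2 * 2 ^ q) ^ n / 2 ^ n" "(norm (fps_nth F n))\<^sup>2 / 2 ^ (n * q)"]
      by simp
    also have "\<dots> = (norm (fps_nth F n) * r ^ n)\<^sup>2 * (1 / 2) ^ n"
    proof -
      have "(2::real) ^ (n * q) = (2 ^ q) ^ n" "(r\<^sup>2) ^ n = (r ^ n)\<^sup>2"
        by (simp_all add: mult.commute flip: power_mult)
      then show ?thesis by (simp add: power_mult_distrib power_one_over divide_simps)
    qed
    also have "\<dots> \<le> K\<^sup>2 * (1 / 2) ^ n"
      using K[of n] r(1) by (intro mult_right_mono power_mono) auto
    finally show "norm ((norm (fps_nth F n))\<^sup>2 / 2 ^ (n * q)) \<le> K\<^sup>2 * (1 / 2) ^ n"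
      by simp
  qed
  then show "\<exists>q. summable (\<lambda>n. (norm (fps_nth F n))\<^sup>2 / 2 ^ (n * q))" ..
next
  assume "\<exists>q. summable (\<lambda>n. (norm (fps_nth F n))\<^sup>2 / 2 ^ (n * q))"
  then obtain q where "summable (\<lambda>n. (norm (fps_nth F n))\<^sup>2 / 2 ^ (n * q))" ..
  then have "Bseq (\<lambda>n. (norm (fps_nth F n))\<^sup>2 / 2 ^ (n * q))"
    by (intro convergent_imp_Bseq convergentI[of _ 0] summable_LIMSEQ_zero)
  then obtain K where K: "(norm (fps_nth F n))\<^sup>2 / 2 ^ (n * q) \<le> K" and "K > 0" for n
    by (auto simp: Bseq_def)
  \<comment> \<open>Chosen so that \<open>2 ^ (n * q) * r ^ n = (1 / 2) ^ n\<close>.\<close>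
  define r :: real where "r = 1 / 2 ^ (q + 1)"
  have "summable (\<lambda>n. fps_nth F n * of_real r ^ n)"
  proof (rule summable_comparison_test')
    show "summable (\<lambda>n. (K + 1) * (1 / 2) ^ n)"
      by (intro summable_mult summable_geometric) auto
    fix n :: nat
    have "(norm (fps_nth F n))\<^sup>2 \<le> K * 2 ^ (n * q)"
      using K[of n] by (simp add: field_simps)
    \<comment> \<open>A wasteful bound, but a perfect square, so the square can be removed from both
      sides.\<close>
    also have "\<dots> \<le> (K + 1)\<^sup>2 * (2 ^ (n * q))\<^sup>2"
    proof (rule mult_mono)
      show "K \<le> (K + 1)\<^sup>2" using \<open>K > 0\<close> by (simp add: power2_eq_square algebra_simps)
      show "(2::real) ^ (n * q) \<le> (2 ^ (n * q))\<^sup>2" by (simp add: power2_eq_square)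
    qed auto
    finally have "(norm (fps_nth F n))\<^sup>2 \<le> ((K + 1) * 2 ^ (n * q))\<^sup>2"
      by (simp add: power_mult_distrib)
    then have "norm (fps_nth F n) \<le> (K + 1) * 2 ^ (n * q)"
      by (rule power2_le_imp_le) (use \<open>K > 0\<close> in auto)
    then have "norm (fps_nth F n) * r ^ n \<le> (K + 1) * 2 ^ (n * q) * r ^ n"
      by (intro mult_right_mono) (auto simp: r_def)
    also have "\<dots> = (K + 1) * (1 / 2) ^ n"
    proof -
      have "(2::real) ^ (n * q) = (2 ^ q) ^ n"
        by (simp add: mult.commute flip: power_mult)
      then show ?thesis by (simp add: r_def power_mult_distrib power_divide power_one_over)
    qed
    finally show "norm (fps_nth F n * of_real r ^ n) \<le> (K + 1) * (1 / 2) ^ n"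
      by (simp add: norm_mult norm_power norm_divide r_def)
  qed
  then have "fps_conv_radius F \<ge> norm (of_real r :: complex)"
    unfolding fps_conv_radius_def by (rule conv_radius_geI)
  moreover have "norm (of_real r :: complex) > 0" by (simp add: r_def)
  ultimately show "fps_conv_radius F > 0"
    by (metis ereal_less(2) less_le_trans)
qed

lemma distributions_iff:
  "\<Phi> \<in> distributions lam \<beta> \<longleftrightarrow>
     (\<exists>F. fps_conv_radius F > 0 \<and> \<Phi> = dual_series lam \<beta> (fps_nth F))"
  unfolding distributions_def dual_space_def fps_conv_radius_pos_iff
proof
  assume "\<Phi> \<in> (\<Union>q. {dual_series lam \<beta> c |c. summable (\<lambda>n. (norm (c n))\<^sup>2 / 2 ^ (n * q))})"
  then obtain q c where "\<Phi> = dual_series lam \<beta> c" "summable (\<lambda>n. (norm (c n))\<^sup>2 / 2 ^ (n * q))"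
    by blast
  then show "\<exists>F. (\<exists>q. summable (\<lambda>n. (norm (fps_nth F n))\<^sup>2 / 2 ^ (n * q))) \<and>
      \<Phi> = dual_series lam \<beta> (fps_nth F)"
    by (intro exI[of _ "Abs_fps c"]) (simp add: Abs_fps_inverse, blast)
qed blast

section \<open>Deconvolution\<close>

text \<open>Splitting \<open>a n * x n\<close> as \<open>sqrt (a n) * (sqrt (a n) * x n)\<close>
  reduces this to the finite inequality; the uniform bound on partial sums gives both convergence
  and the estimate.\<close>

lemma Cauchy_Schwarz_suminf_weighted:
  fixes a x :: "nat \<Rightarrow> real"
  assumes a: "summable a" "\<And>n. a n \<ge> 0" and x: "\<And>n. x n \<ge> 0"
    and ax: "summable (\<lambda>n. a n * (x n)\<^sup>2)"
  shows "summable (\<lambda>n. a n * x n)"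
    and "(\<Sum>n. a n * x n)\<^sup>2 \<le> (\<Sum>n. a n) * (\<Sum>n. a n * (x n)\<^sup>2)"
proof -
  let ?B = "(\<Sum>n. a n) * (\<Sum>n. a n * (x n)\<^sup>2)"
  have fin: "(\<Sum>i<n. a i * x i) \<le> sqrt ?B" for n
  proof -
    have "(\<Sum>i<n. a i * x i)\<^sup>2 = (\<Sum>i<n. sqrt (a i) * (sqrt (a i) * x i))\<^sup>2"
      using a(2) by (simp flip: mult.assoc)
    also have "\<dots> \<le> (\<Sum>i<n. (sqrt (a i))\<^sup>2) * (\<Sum>i<n. (sqrt (a i) * x i)\<^sup>2)"
      by (rule Cauchy_Schwarz_ineq_sum)
    also have "\<dots> = (\<Sum>i<n. a i) * (\<Sum>i<n. a i * (x i)\<^sup>2)"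
      using a(2) by (simp add: power_mult_distrib)
    also have "\<dots> \<le> ?B"
      using a ax by (intro mult_mono sum_le_suminf suminf_nonneg sum_nonneg) auto
    finally show ?thesis
      by (rule real_le_rsqrt)
  qed
  show sm: "summable (\<lambda>n. a n * x n)"
    using fin a(2) x by (intro summableI_nonneg_bounded[where x = "sqrt ?B"]) auto
  have "(\<Sum>n. a n * x n) \<le> sqrt ?B"
    using sm fin by (intro suminf_le_const) auto
  then have "(\<Sum>n. a n * x n)\<^sup>2 \<le> (sqrt ?B)\<^sup>2"
    using a(2) x sm by (intro power_mono suminf_nonneg) auto
  also have "(sqrt ?B)\<^sup>2 = ?B"
    using a ax by (intro real_sqrt_pow2 mult_nonneg_nonneg suminf_nonneg) auto
  finally show "(\<Sum>n. a n * x n)\<^sup>2 \<le> ?B" .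
qed

text \<open>A Young inequality for correlation with a summable \<open>a\<close>: Cauchy-Schwarz
  bounds each square, and since \<open>W\<close> increases, moving from \<open>j\<close> to
  \<open>j + m\<close> can only raise the weight.\<close>

lemma summable_weighted_square_convolution:
  fixes a y W :: "nat \<Rightarrow> real"
  assumes a: "summable a" "\<And>n. a n \<ge> 0" and y: "\<And>n. y n \<ge> 0"
    and W: "mono W" "\<And>n. W n \<ge> 1" and Wy: "summable (\<lambda>n. W n * (y n)\<^sup>2)"
  shows "summable (\<lambda>m. a m * y (j + m))"
    and "summable (\<lambda>j. W j * (\<Sum>m. a m * y (j + m))\<^sup>2)"
proof -
  define Y where "Y = (\<Sum>n. W n * (y n)\<^sup>2)"
  have W0: "W n \<ge> 0" for n using W(2)[of n] by linarith
  have part: "(\<Sum>j<N. W j * (y (j + m))\<^sup>2) \<le> Y" for N m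
  proof -
    have "(\<Sum>j<N. W j * (y (j + m))\<^sup>2) \<le> (\<Sum>j<N. W (j + m) * (y (j + m))\<^sup>2)"
      by (intro sum_mono mult_right_mono monoD[OF W(1)]) auto
    also have "\<dots> = (\<Sum>j\<in>{0 + m..<N + m}. W j * (y j)\<^sup>2)"
      unfolding sum.shift_bounds_nat_ivl by (simp add: lessThan_atLeast0)
    also have "\<dots> \<le> Y"
      unfolding Y_def using Wy W0 by (intro sum_le_suminf) auto
    finally show ?thesis .
  qed
  have y2: "(y n)\<^sup>2 \<le> Y" for n
  proof -
    have "(y n)\<^sup>2 \<le> W n * (y n)\<^sup>2"
      using mult_right_mono[OF W(2)[of n], of "(y n)\<^sup>2"] by simp
    also have "\<dots> \<le> Y"
      unfolding Y_def using sum_le_suminf[OF Wy, of "{n}"] W0 by auto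
    finally show ?thesis .
  qed
  have ay: "summable (\<lambda>m. a m * (y (j + m))\<^sup>2)" for j
    by (rule summable_comparison_test'[OF summable_mult2[OF a(1), of Y], where N = 0])
      (use a(2) y2 in \<open>auto simp: abs_mult intro!: mult_left_mono\<close>)
  note CS = Cauchy_Schwarz_suminf_weighted[OF a y ay]
  show "summable (\<lambda>m. a m * y (j + m))" by (rule CS(1))
  have "(\<Sum>j<N. W j * (\<Sum>m. a m * y (j + m))\<^sup>2) \<le> (\<Sum>n. a n) * ((\<Sum>n. a n) * Y)" for N
  proof -
    have "(\<Sum>j<N. W j * (\<Sum>m. a m * y (j + m))\<^sup>2) \<le>
        (\<Sum>j<N. W j * ((\<Sum>n. a n) * (\<Sum>m. a m * (y (j + m))\<^sup>2)))"
      by (intro sum_mono mult_left_mono CS(2) W0)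
    also have "\<dots> = (\<Sum>n. a n) * (\<Sum>j<N. \<Sum>m. W j * (a m * (y (j + m))\<^sup>2))"
      using ay by (simp add: sum_distrib_left suminf_mult mult_ac)
    also have "(\<Sum>j<N. \<Sum>m. W j * (a m * (y (j + m))\<^sup>2)) = (\<Sum>m. \<Sum>j<N. W j * (a m * (y (j + m))\<^sup>2))"
      using ay by (intro suminf_sum[symmetric] summable_mult)
    also have "\<dots> = (\<Sum>m. a m * (\<Sum>j<N. W j * (y (j + m))\<^sup>2))"
      by (simp add: sum_distrib_left mult_ac)
    also have "\<dots> \<le> (\<Sum>m. a m * Y)"
    proof (rule suminf_le)
      show "a m * (\<Sum>j<N. W j * (y (j + m))\<^sup>2) \<le> a m * Y" for m
        by (intro mult_left_mono part a)
      show "summable (\<lambda>m. a m * Y)" using a(1) by (rule summable_mult2)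
      have "summable (\<lambda>m. \<Sum>j<N. W j * (a m * (y (j + m))\<^sup>2))"
        using ay by (intro summable_sum summable_mult)
      then show "summable (\<lambda>m. a m * (\<Sum>j<N. W j * (y (j + m))\<^sup>2))"
        by (simp add: sum_distrib_left mult_ac)
    qed
    also have "\<dots> = (\<Sum>n. a n) * Y"
      using a(1) by (rule suminf_mult2[symmetric])
    finally show ?thesis
      using a by (simp add: mult_left_mono suminf_nonneg)
  qed
  then show "summable (\<lambda>j. W j * (\<Sum>m. a m * y (j + m))\<^sup>2)"
    using W0 by (intro summableI_nonneg_bounded) auto
qed

text \<open>The double series of \<open>fps_nth U j * fps_nth A m * d (k + j + m)\<close> is summed
  twice. Over \<open>j\<close> first it is \<open>0\<close> by \<open>zero\<close>; along
  \<open>j + m = n\<close> it gives the coefficients of \<open>A * U = 1\<close>, so only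
  \<open>d k\<close> survives. \<open>inner\<close> and \<open>outer\<close> give the absolute
  convergence.\<close>

lemma deconvolution_eq_0:
  fixes A U :: "complex fps" and d :: "nat \<Rightarrow> complex"
  assumes AU: "A * U = 1"
    and inner: "\<And>j. summable (\<lambda>m. norm (fps_nth A m) * norm (d (k + j + m)))"
    and outer: "summable (\<lambda>j. norm (fps_nth U j) * (\<Sum>m. norm (fps_nth A m) * norm (d (k + j + m))))"
    and zero: "\<And>m. (\<lambda>j. d (j + m) * fps_nth U j) sums 0"
  shows "d k = 0"
proof -
  define F where "F = (\<lambda>(j, m). fps_nth U j * fps_nth A m * d (k + j + m))"
  have "(\<lambda>p. norm (F p)) summable_on (UNIV \<times> UNIV)"
  proof (rule summable_on_SigmaI)
    fix j :: nat
    have "(\<lambda>m. norm (fps_nth U j) * (norm (fps_nth A m) * norm (d (k + j + m)))) sums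
        (norm (fps_nth U j) * (\<Sum>m. norm (fps_nth A m) * norm (d (k + j + m))))"
      by (intro sums_mult summable_sums inner)
    then show "((\<lambda>m. norm (F (j, m))) has_sum
        norm (fps_nth U j) * (\<Sum>m. norm (fps_nth A m) * norm (d (k + j + m)))) UNIV"
      by (intro sums_nonneg_imp_has_sum) (auto simp: F_def norm_mult mult_ac)
  next
    show "(\<lambda>j. norm (fps_nth U j) * (\<Sum>m. norm (fps_nth A m) * norm (d (k + j + m)))) summable_on UNIV"
      using outer inner by (intro summable_nonneg_imp_summable_on) (auto intro!: mult_nonneg_nonneg suminf_nonneg)
  qed auto
  then have "F summable_on (UNIV \<times> UNIV)"
    by (rule abs_summable_summable)
  then obtain S where S: "(F has_sum S) (UNIV \<times> UNIV)"
    by (auto simp: summable_on_def)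
  have "((\<lambda>_. 0) has_sum S) (UNIV :: nat set)"
  proof (rule has_sum_SigmaD[where B = "\<lambda>_. UNIV :: nat set"])
    show sw: "((\<lambda>(m, j). F (j, m)) has_sum S) (UNIV \<times> UNIV)"
      using S by (subst (asm) has_sum_swap) simp
    fix m :: nat
    have "(\<lambda>j. fps_nth A m * (d (j + (k + m)) * fps_nth U j)) sums (fps_nth A m * 0)"
      by (intro sums_mult zero)
    then have s0: "(\<lambda>j. F (j, m)) sums 0"
      by (simp add: F_def mult_ac add_ac)
    have "(\<lambda>j. F (j, m)) summable_on UNIV"
      using summable_on_SigmaD1[of "\<lambda>m j. F (j, m)" UNIV "\<lambda>_. UNIV" m] sw
      by (auto simp: summable_on_def)
    then obtain s where s: "((\<lambda>j. F (j, m)) has_sum s) UNIV"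
      by (auto simp: summable_on_def)
    with s0 have "s = 0"
      using has_sum_imp_sums sums_unique2 by blast
    with s show "((\<lambda>j. case (m, j) of (m, j) \<Rightarrow> F (j, m)) has_sum 0) UNIV"
      by simp
  qed
  then have "S = 0"
    by (rule has_sum_unique) simp
  \<comment> \<open>Second order of summation: the antidiagonals \<open>n = j + m\<close>, each
    carrying a finite Cauchy product.\<close>
  have diag: "((\<lambda>(n, j). F (j, n - j)) has_sum S) (SIGMA n:UNIV. {..n})"
  proof -
    have "bij_betw (\<lambda>(n, j). (j, n - j)) (SIGMA n:UNIV. {..n}) (UNIV \<times> UNIV :: (nat \<times> nat) set)"
      by (rule bij_betwI[where g = "\<lambda>(j, m). (j + m, j)"]) auto
    from has_sum_reindex_bij_betw[OF this, of F S] S show ?thesis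
      by (simp add: case_prod_unfold)
  qed
  have "((\<lambda>n. \<Sum>j\<le>n. F (j, n - j)) has_sum S) UNIV"
    by (rule has_sum_SigmaD[OF diag]) simp
  moreover have "(\<Sum>j\<le>n. F (j, n - j)) = (if n = 0 then d k else 0)" for n
  proof -
    have "(\<Sum>j\<le>n. F (j, n - j)) = (\<Sum>j\<le>n. fps_nth U j * fps_nth A (n - j)) * d (k + n)"
      by (simp add: F_def sum_distrib_right)
    also have "(\<Sum>j\<le>n. fps_nth U j * fps_nth A (n - j)) = fps_nth (A * U) n"
      by (simp add: fps_mult_nth atLeast0AtMost mult.commute[of A])
    finally show ?thesis by (simp add: AU)
  qed
  ultimately have "((\<lambda>n. if n = 0 then d k else 0) has_sum S) (UNIV :: nat set)"
    by simp
  then have "(\<lambda>n. if n = 0 then d k else 0) sums S"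
    by (rule has_sum_imp_sums)
  then have "S = d k"
    using sums_single[of 0 "\<lambda>_. d k"] sums_unique2 by blast
  with \<open>S = 0\<close> show ?thesis by simp
qed

section \<open>The generalized Appell polynomials\<close>

text \<open>The denominator of \<open>wick_exp\<close> in the coordinate
  \<open>w = exp z - 1\<close>.\<close>

definition scaled_mittag_leffler_fps :: "real \<Rightarrow> real \<Rightarrow> complex fps" where
  "scaled_mittag_leffler_fps lam \<beta> =
     Abs_fps (\<lambda>n. of_real lam ^ n * fps_nth (mittag_leffler_fps \<beta>) n)"

lemma scaled_mittag_leffler_sums:
  assumes "0 < \<beta>"
  shows "(\<lambda>n. fps_nth (scaled_mittag_leffler_fps lam \<beta>) n * w ^ n) sums
    mittag_leffler \<beta> (of_real lam * w)"
  using sums_eval_fps[of "of_real lam * w" "mittag_leffler_fps \<beta>"] assms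
  by (simp add: scaled_mittag_leffler_fps_def mittag_leffler_eq_eval_fps power_mult_distrib mult_ac)

lemma scaled_mittag_leffler_has_fps_expansion:
  assumes "0 < \<beta>"
  shows "(\<lambda>w. mittag_leffler \<beta> (of_real lam * w)) has_fps_expansion scaled_mittag_leffler_fps lam \<beta>"
  using scaled_mittag_leffler_sums[OF assms] by (intro has_fps_expansionI always_eventually) auto

lemma scaled_mittag_leffler_nth_0 [simp]: "fps_nth (scaled_mittag_leffler_fps lam \<beta>) 0 = 1"
  by (simp add: scaled_mittag_leffler_fps_def mittag_leffler_fps_def)

lemma norm_summable_scaled_mittag_leffler:
  assumes "0 < \<beta>"
  shows "summable (\<lambda>n. norm (fps_nth (scaled_mittag_leffler_fps lam \<beta>) n))"
  using powser_insidea[OF sums_summable[OF scaled_mittag_leffler_sums[OF assms, of lam 2]], of 1]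
  by simp

text \<open>At a natural number \<open>N\<close> the numerator of the generating function is the
  polynomial \<open>(1 + w) ^ N\<close>, which makes the Appell values accessible to formal power
  series.\<close>

lemma appell_C_of_nat:
  assumes "0 < \<beta>"
  shows "appell_C lam \<beta> n (real N) = fact n *
    fps_nth ((1 + fps_X) ^ N * inverse (scaled_mittag_leffler_fps lam \<beta>)) n"
proof -
  let ?A = "scaled_mittag_leffler_fps lam \<beta>"
  have expansion: "(\<lambda>w. (1 + w) ^ N * inverse (mittag_leffler \<beta> (of_real lam * w))) has_fps_expansion
      (1 + fps_X) ^ N * inverse ?A"
    by (intro fps_expansion_intros scaled_mittag_leffler_has_fps_expansion assms) auto
  have "\<forall>\<^sub>F w in nhds 0. w \<in> - {- 1 :: complex}"
    by (rule eventually_nhds_in_open) auto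
  then have "\<forall>\<^sub>F w in nhds 0. (1 + w) ^ N * inverse (mittag_leffler \<beta> (of_real lam * w)) =
      wick_exp lam \<beta> (Ln (1 + w)) (real N)"
  proof eventually_elim
    case (elim w)
    then have "1 + w \<noteq> 0" by (metis Compl_iff add_eq_0_iff insertI1)
    then show ?case
      by (simp add: wick_exp_def mult.commute[of _ "of_nat N"] exp_of_nat_mult divide_inverse)
  qed
  from has_fps_expansion_cong[OF this refl] expansion
  have "(\<lambda>w. wick_exp lam \<beta> (Ln (1 + w)) (real N)) has_fps_expansion
      (1 + fps_X) ^ N * inverse ?A"
    by (rule iffD1)
  from fps_nth_fps_expansion[OF this, of n] show ?thesis
    by (simp add: appell_C_def)
qed

text \<open>One radius serves all \<open>x\<close>: it only has to avoid the zeros of the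
  denominator and the branch cut of \<open>Ln (1 + w)\<close>, and neither depends on
  \<open>x\<close>.\<close>

lemma wick_exp_Ln_holomorphic:
  assumes "0 < \<beta>"
  obtains r where "0 < r" "\<And>x. (\<lambda>w. wick_exp lam \<beta> (Ln (1 + w)) x) holomorphic_on ball 0 r"
proof -
  have "(\<lambda>w. mittag_leffler \<beta> (of_real lam * w)) holomorphic_on UNIV"
    using assms by (intro holomorphic_intros)
  then have "isCont (\<lambda>w. mittag_leffler \<beta> (of_real lam * w)) 0"
    by (metis UNIV_I continuous_on_eq_continuous_at holomorphic_on_imp_continuous_on open_UNIV)
  then have "((\<lambda>w. mittag_leffler \<beta> (of_real lam * w)) \<longlongrightarrow> 1) (nhds 0)"
    using tendsto_at_iff_tendsto_nhds[of "\<lambda>w. mittag_leffler \<beta> (of_real lam * w)" 0]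
    by (simp add: isCont_def)
  then have "\<forall>\<^sub>F w in nhds 0. mittag_leffler \<beta> (of_real lam * w) \<noteq> 0"
    by (rule tendsto_imp_eventually_ne) simp
  then obtain r where r: "r > 0" "\<And>w. norm w < r \<Longrightarrow> mittag_leffler \<beta> (of_real lam * w) \<noteq> 0"
    by (auto simp: eventually_nhds_metric)
  have slit: "1 + w \<notin> \<real>\<^sub>\<le>\<^sub>0" if "norm w < 1" for w :: complex
    using that abs_Re_le_cmod[of w] by (auto simp: complex_nonpos_Reals_iff)
  have hol: "(\<lambda>w. exp (Ln (1 + w) * of_real x) / mittag_leffler \<beta> (of_real lam * w))
      holomorphic_on ball 0 (min r 1)" for x
    using assms slit r(2) by (intro holomorphic_intros) auto
  have "(\<lambda>w. wick_exp lam \<beta> (Ln (1 + w)) x) holomorphic_on ball 0 (min r 1)" for x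
  proof (rule holomorphic_transform[OF hol[of x]])
    fix w :: complex assume "w \<in> ball 0 (min r 1)"
    then have "1 + w \<noteq> 0" using slit[of w] by auto
    then show "exp (Ln (1 + w) * of_real x) / mittag_leffler \<beta> (of_real lam * w) =
        wick_exp lam \<beta> (Ln (1 + w)) x"
      by (simp add: wick_exp_def)
  qed
  with r(1) show ?thesis by (intro that[of "min r 1"]) auto
qed

lemma appell_C_sums:
  assumes "0 < \<beta>"
  obtains r where "0 < r" "\<And>x w. norm w < r \<Longrightarrow>
    (\<lambda>n. appell_C lam \<beta> n x / fact n * w ^ n) sums wick_exp lam \<beta> (Ln (1 + w)) x"
proof -
  obtain r where r: "0 < r" "\<And>x. (\<lambda>w. wick_exp lam \<beta> (Ln (1 + w)) x) holomorphic_on ball 0 r"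
    using wick_exp_Ln_holomorphic[OF assms] by blast
  show ?thesis
  proof (rule that[OF r(1)])
    fix x and w :: complex assume "norm w < r"
    then show "(\<lambda>n. appell_C lam \<beta> n x / fact n * w ^ n) sums wick_exp lam \<beta> (Ln (1 + w)) x"
      using holomorphic_power_series[OF r(2), of w x] by (simp add: appell_C_def)
  qed
qed

section \<open>Coefficients of test functions\<close>

lemma test_space_antimono:
  assumes "p \<le> q"
  shows "test_space q \<subseteq> test_space p"
proof
  fix a assume "a \<in> test_space q"
  then have "summable (\<lambda>n. (fact n)\<^sup>2 * 2 ^ (n * q) * (norm (a n))\<^sup>2)"
    by (simp add: test_space_def)
  then have "summable (\<lambda>n. (fact n)\<^sup>2 * 2 ^ (n * p) * (norm (a n))\<^sup>2)"
    by (rule summable_comparison_test'[where N = 0])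
      (use assms in \<open>auto intro!: mult_right_mono mult_left_mono power_increasing\<close>)
  then show "a \<in> test_space p" by (simp add: test_space_def)
qed

lemma test_space_diff:
  assumes "a \<in> test_space q" "b \<in> test_space q"
  shows "(\<lambda>n. a n - b n) \<in> test_space q"
proof -
  have "summable (\<lambda>n. 2 * ((fact n)\<^sup>2 * 2 ^ (n * q) * (norm (a n))\<^sup>2) +
      2 * ((fact n)\<^sup>2 * 2 ^ (n * q) * (norm (b n))\<^sup>2))"
    using assms by (intro summable_add summable_mult) (auto simp: test_space_def)
  then have "summable (\<lambda>n. (fact n)\<^sup>2 * 2 ^ (n * q) * (norm (a n - b n))\<^sup>2)"
  proof (rule summable_comparison_test'[where N = 0])
    fix n
    have "(norm (a n - b n))\<^sup>2 \<le> (norm (a n) + norm (b n))\<^sup>2"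
      by (intro power_mono norm_triangle_ineq4) auto
    also have "\<dots> \<le> 2 * (norm (a n))\<^sup>2 + 2 * (norm (b n))\<^sup>2"
      using sum_squares_bound[of "norm (a n)" "norm (b n)"] by (simp add: power2_sum)
    finally have "(fact n)\<^sup>2 * 2 ^ (n * q) * (norm (a n - b n))\<^sup>2 \<le>
        (fact n)\<^sup>2 * 2 ^ (n * q) * (2 * (norm (a n))\<^sup>2 + 2 * (norm (b n))\<^sup>2)"
      by (intro mult_left_mono) auto
    then show "norm ((fact n)\<^sup>2 * 2 ^ (n * q) * (norm (a n - b n))\<^sup>2) \<le>
        2 * ((fact n)\<^sup>2 * 2 ^ (n * q) * (norm (a n))\<^sup>2) +
        2 * ((fact n)\<^sup>2 * 2 ^ (n * q) * (norm (b n))\<^sup>2)"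
      by (simp add: algebra_simps)
  qed
  then show ?thesis by (simp add: test_space_def)
qed

text \<open>\<open>fact n * norm (a n)\<close> decays at least like \<open>(1 / 2 ^ p) ^ n\<close>,
  while \<open>appell_C lam \<beta> n x / fact n\<close> grows at most like
  \<open>(2 / r) ^ n\<close>, with \<open>r\<close> uniform in \<open>x\<close>. The index is
  \<open>2 * p\<close> because \<open>test_space\<close> bounds squares.\<close>

lemma pointwise_convergent_exists:
  assumes "0 < \<beta>"
  obtains q where "pointwise_convergent lam \<beta> q"
proof -
  obtain r where r: "0 < r" "\<And>x w. norm w < r \<Longrightarrow>
      (\<lambda>n. appell_C lam \<beta> n x / fact n * w ^ n) sums wick_exp lam \<beta> (Ln (1 + w)) x"
    using appell_C_sums[OF assms] by blast
  \<comment> \<open>The threshold is twice the growth rate \<open>2 / r\<close>, which leaves a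
    geometric factor \<open>1 / 2\<close>.\<close>
  obtain p where p: "4 / r < 2 ^ p"
    using real_arch_pow[of 2 "4 / r"] by auto
  have "summable (\<lambda>n. norm (a n * appell_C lam \<beta> n x))" if a: "a \<in> test_space (2 * p)" for a x
  proof -
    have "Bseq (\<lambda>n. (fact n)\<^sup>2 * 2 ^ (n * (2 * p)) * (norm (a n))\<^sup>2)"
      using a by (intro convergent_imp_Bseq convergentI[of _ 0] summable_LIMSEQ_zero)
        (simp add: test_space_def)
    then obtain K where K: "K > 0" "(fact n)\<^sup>2 * 2 ^ (n * (2 * p)) * (norm (a n))\<^sup>2 \<le> K" for n
      by (auto simp: Bseq_def)
    have K': "fact n * (2 ^ p) ^ n * norm (a n) \<le> sqrt K" for n
    proof (rule real_le_rsqrt)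
      have "(2::real) ^ (n * (2 * p)) = ((2 ^ p) ^ n)\<^sup>2"
        by (simp add: mult_ac flip: power_mult)
      then show "(fact n * (2 ^ p) ^ n * norm (a n))\<^sup>2 \<le> K"
        using K(2)[of n] by (simp add: power_mult_distrib)
    qed
    have "Bseq (\<lambda>n. appell_C lam \<beta> n x / fact n * of_real (r / 2) ^ n)"
      using r(2)[of "of_real (r / 2)" x] r(1)
      by (intro convergent_imp_Bseq convergentI[of _ 0] summable_LIMSEQ_zero)
        (auto simp: sums_iff norm_divide)
    then obtain M where M: "M > 0" "norm (appell_C lam \<beta> n x) / fact n * (r / 2) ^ n \<le> M" for n
      using r(1) by (auto simp: Bseq_def norm_mult norm_divide norm_power)
    show ?thesis
    proof (rule summable_comparison_test'[where N = 0])
      show "summable (\<lambda>n. sqrt K * M * (1 / 2) ^ n)"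
        by (intro summable_mult summable_geometric) auto
      fix n :: nat
      have "2 \<le> 2 ^ p * (r / 2)"
        using p r(1) by (simp add: field_simps)
      then have "2 ^ n \<le> (2 ^ p * (r / 2)) ^ n"
        by (rule power_mono) simp
      then have "norm (a n * appell_C lam \<beta> n x) \<le>
          norm (a n * appell_C lam \<beta> n x) * ((2 ^ p * (r / 2)) ^ n / 2 ^ n)"
        using mult_left_mono[of 1 "(2 ^ p * (r / 2)) ^ n / 2 ^ n" "norm (a n * appell_C lam \<beta> n x)"]
        by simp
      also have "\<dots> = (fact n * (2 ^ p) ^ n * norm (a n)) *
          (norm (appell_C lam \<beta> n x) / fact n * (r / 2) ^ n) * (1 / 2) ^ n"
        by (simp add: norm_mult power_mult_distrib power_one_over divide_simps)
      also have "\<dots> \<le> sqrt K * M * (1 / 2) ^ n"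
        using K' M K(1) r(1) by (intro mult_right_mono mult_mono) auto
      finally show "norm (norm (a n * appell_C lam \<beta> n x)) \<le> sqrt K * M * (1 / 2) ^ n"
        by simp
    qed
  qed
  then show ?thesis
    by (intro that[of "2 * p"]) (auto simp: pointwise_convergent_def)
qed

text \<open>Subtracting the hypothesis for \<open>N\<close> from that for \<open>Suc N\<close>
  replaces the series by its product with \<open>fps_X\<close>, that is, shifts \<open>d\<close> by
  one; hence the induction with \<open>d\<close> arbitrary.\<close>

lemma sums_shift_eq_0:
  fixes U :: "complex fps"
  assumes "\<And>N. (\<lambda>n. d n * fps_nth ((1 + fps_X) ^ N * U) n) sums 0"
  shows "(\<lambda>n. d (n + m) * fps_nth U n) sums 0"
  using assms
proof (induction m arbitrary: d)
  case 0
  from "0.prems"[of 0] show ?case by simp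
next
  case (Suc m)
  have "(\<lambda>n. d (Suc n) * fps_nth ((1 + fps_X) ^ N * U) n) sums 0" for N
  proof -
    let ?G = "(1 + fps_X) ^ N * U"
    have "fps_nth ((1 + fps_X) ^ Suc N * U) n - fps_nth ?G n =
        (if n = 0 then 0 else fps_nth ?G (n - 1))" for n
      by (simp add: distrib_right mult.assoc)
    then have "(\<lambda>n. d n * (if n = 0 then 0 else fps_nth ?G (n - 1))) sums 0"
      using sums_diff[OF Suc.prems[of "Suc N"] Suc.prems[of N]]
      by (simp flip: right_diff_distrib)
    then show ?thesis
      using sums_Suc_iff[of "\<lambda>n. d n * (if n = 0 then 0 else fps_nth ?G (n - 1))" 0] by simp
  qed
  from Suc.IH[OF this] show ?case by simp
qed

text \<open>Testing at \<open>x = 0, 1, 2, \<dots>\<close> amounts to pairing \<open>n! a n\<close> with \<open>(1 + w) ^ x / E (lam * w)\<close>, hence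
  with all \<open>w ^ m / E (lam * w)\<close>; multiplying by the entire function \<open>E (lam * w)\<close> recovers every \<open>a n\<close>.\<close>

lemma appell_C_series_eq_0:
  assumes \<beta>: "0 < \<beta>" and pc: "pointwise_convergent lam \<beta> q" and a: "a \<in> test_space q"
    and zero: "\<And>N. (\<lambda>n. a n * appell_C lam \<beta> n (real N)) sums 0"
  shows "a k = 0"
proof -
  define A where "A = scaled_mittag_leffler_fps lam \<beta>"
  define U where "U = inverse A"
  define d where "d n = fact n * a n" for n
  have AU: "A * U = 1"
    unfolding U_def by (rule inverse_mult_eq_1') (simp add: A_def)
  have CU: "appell_C lam \<beta> n 0 = fact n * fps_nth U n" for n
    using appell_C_of_nat[OF \<beta>, of lam n 0] by (simp add: U_def A_def)
  have "(\<lambda>n. d n * fps_nth ((1 + fps_X) ^ N * U) n) sums 0" for N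
    using zero[of N] by (simp add: appell_C_of_nat[OF \<beta>] d_def U_def A_def mult_ac)
  note shifted = sums_shift_eq_0[OF this]
  define W where "W n = (2::real) ^ (n * q)" for n
  have W: "mono W" "\<And>n. W n \<ge> 1"
    by (auto simp: W_def intro!: monoI power_increasing)
  have "summable (\<lambda>n. W n * (norm (d n))\<^sup>2)"
    using a by (simp add: test_space_def W_def d_def norm_mult power_mult_distrib mult_ac)
  then have "summable (\<lambda>n. W (n + k) * (norm (d (n + k)))\<^sup>2)"
    by (rule summable_ignore_initial_segment)
  then have Wd: "summable (\<lambda>n. W n * (norm (d (k + n)))\<^sup>2)"
    by (rule summable_comparison_test'[where N = 0])
      (use W(2) in \<open>auto simp: add.commute[of k] W_def intro!: mult_right_mono power_increasing\<close>)
  have sA: "summable (\<lambda>n. norm (fps_nth A n))"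
    unfolding A_def by (rule norm_summable_scaled_mittag_leffler[OF \<beta>])
  note conv = summable_weighted_square_convolution[OF sA norm_ge_zero norm_ge_zero W Wd]
  define D where "D j = (\<Sum>m. norm (fps_nth A m) * norm (d (k + (j + m))))" for j
  \<comment> \<open>The majorant \<open>D\<close> itself becomes the coefficient sequence of a test
    element. Pointwise convergence at \<open>x = 0\<close>, where \<open>appell_C\<close> is
    \<open>fact j * fps_nth U j\<close>, then yields the outer summability.\<close>
  have "(\<lambda>j. of_real (D j / fact j)) \<in> test_space q"
    using conv(2) by (simp add: test_space_def D_def W_def norm_divide power_divide mult_ac)
  then have "summable (\<lambda>j. norm (of_real (D j / fact j) * appell_C lam \<beta> j 0))"
    using pc by (simp only: pointwise_convergent_def)
  moreover have "D j \<ge> 0" for j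
    unfolding D_def using conv(1) by (intro suminf_nonneg) auto
  ultimately have "summable (\<lambda>j. norm (fps_nth U j) * D j)"
    by (simp add: CU norm_mult norm_divide mult_ac)
  then have "d k = 0"
    using conv(1) by (intro deconvolution_eq_0[OF AU _ _ shifted]) (simp_all add: D_def add.assoc)
  then show ?thesis by (simp add: d_def)
qed

lemma test_coeff_eqI:
  assumes \<beta>: "0 < \<beta>" and q: "pointwise_convergent lam \<beta> q" "a \<in> test_space q"
    and sums: "\<And>x. (\<lambda>n. a n * appell_C lam \<beta> n x) sums \<phi> x"
  shows "test_coeff lam \<beta> \<phi> = a"
  unfolding test_coeff_def
proof (rule the_equality)
  show "(\<exists>q. pointwise_convergent lam \<beta> q \<and> a \<in> test_space q) \<and>
      (\<forall>x. (\<lambda>n. a n * appell_C lam \<beta> n x) sums \<phi> x)"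
    using q sums by blast
next
  fix b
  assume b: "(\<exists>q. pointwise_convergent lam \<beta> q \<and> b \<in> test_space q) \<and>
      (\<forall>x. (\<lambda>n. b n * appell_C lam \<beta> n x) sums \<phi> x)"
  then obtain p where p: "pointwise_convergent lam \<beta> p" "b \<in> test_space p" by blast
  \<comment> \<open>\<open>min p q\<close> is one of the two indices, hence pointwise convergent,
    and its test space contains both sequences.\<close>
  have pc: "pointwise_convergent lam \<beta> (min p q)"
    using p(1) q(1) by (simp add: min_def)
  have "b \<in> test_space (min p q)" "a \<in> test_space (min p q)"
    using p(2) q(2) test_space_antimono[of "min p q" p] test_space_antimono[of "min p q" q] by auto
  note ts = test_space_diff[OF this]
  have "(\<lambda>n. (b n - a n) * appell_C lam \<beta> n (real N)) sums 0" for N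
    using sums_diff[OF b[THEN conjunct2, rule_format, of "real N"] sums[of "real N"]]
    by (simp add: left_diff_distrib)
  from appell_C_series_eq_0[OF \<beta> pc ts this] show "b = a"
    by (auto simp: fun_eq_iff)
qed

section \<open>The transform as a map to germs\<close>

lemma eventually_exp_minus_1:
  assumes "\<forall>\<^sub>F w in nhds 0. P w"
  shows "\<forall>\<^sub>F z in nhds 0. P (exp z - 1 :: complex)"
proof -
  have "isCont (\<lambda>z::complex. exp z - 1) 0" by (intro continuous_intros)
  then have "filterlim (\<lambda>z::complex. exp z - 1) (nhds 0) (nhds 0)"
    using tendsto_at_iff_tendsto_nhds[of "\<lambda>z::complex. exp z - 1" 0] by (simp add: isCont_def)
  then show ?thesis using assms by (rule eventually_compose_filterlim[rotated])
qed

text \<open>\<open>Ln (1 + w)\<close> is a local inverse of \<open>exp z - 1\<close>, so germs in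
  \<open>z\<close> can be compared as germs in \<open>w\<close>.\<close>

lemma eventually_exp_minus_1_iff:
  "(\<forall>\<^sub>F z in nhds 0. P (exp z - 1 :: complex)) \<longleftrightarrow> (\<forall>\<^sub>F w in nhds 0. P w)"
proof
  assume *: "\<forall>\<^sub>F z in nhds 0. P (exp z - 1)"
  have "isCont (\<lambda>w. Ln (1 + w)) 0" by (intro continuous_intros) auto
  then have "filterlim (\<lambda>w. Ln (1 + w)) (nhds 0) (nhds 0)"
    using tendsto_at_iff_tendsto_nhds[of "\<lambda>w. Ln (1 + w)" 0] by (simp add: isCont_def)
  from eventually_compose_filterlim[OF * this]
  have "\<forall>\<^sub>F w in nhds 0. P (exp (Ln (1 + w)) - 1)" .
  moreover have "\<forall>\<^sub>F w in nhds 0. w \<in> - {- 1 :: complex}"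
    by (rule eventually_nhds_in_open) auto
  ultimately show "\<forall>\<^sub>F w in nhds 0. P w"
  proof eventually_elim
    case (elim w)
    then have "1 + w \<noteq> 0" by (metis Compl_iff add_eq_0_iff insertI1)
    with elim(1) show ?case by simp
  qed
qed (rule eventually_exp_minus_1)

text \<open>With \<open>w = exp z - 1\<close>, \<open>wick_exp\<close> has coefficients
  \<open>w ^ n / fact n\<close>, and the factorials cancel in the pairing. The neighbourhood is
  independent of \<open>F\<close> because both sides are the same \<open>suminf\<close>, convergent
  or not.\<close>

lemma S_transform_dual_series:
  assumes "lam > 0" "0 < \<beta>"
  shows "\<forall>\<^sub>F z in nhds 0. \<forall>F.
    S_transform lam \<beta> (dual_series lam \<beta> (fps_nth F)) z = eval_fps F (exp z - 1)"
proof -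
  obtain r where r: "0 < r" "\<And>x w. norm w < r \<Longrightarrow>
      (\<lambda>n. appell_C lam \<beta> n x / fact n * w ^ n) sums wick_exp lam \<beta> (Ln (1 + w)) x"
    using appell_C_sums[OF assms(2)] by blast
  obtain q where q: "pointwise_convergent lam \<beta> q"
    using pointwise_convergent_exists[OF assms(2)] .
  \<comment> \<open>\<open>r\<close> makes the generating function valid; \<open>1 / 2 ^ q\<close>
    puts the coefficients into \<open>test_space q\<close>.\<close>
  define s where "s = min r (1 / 2 ^ q)"
  have s: "s > 0" using r(1) by (simp add: s_def)
  have "\<forall>\<^sub>F w in nhds (0::complex). norm w < s"
    using s by (auto simp: eventually_nhds_metric)
  then have "\<forall>\<^sub>F z in nhds 0. norm (exp z - 1 :: complex) < s"
    by (rule eventually_exp_minus_1[of "\<lambda>w. norm w < s"])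
  \<comment> \<open>This keeps \<open>Im z\<close> strictly between \<open>- pi\<close> and
    \<open>pi\<close>, so that \<open>Ln\<close> undoes \<open>exp\<close>.\<close>
  moreover have "\<forall>\<^sub>F z in nhds 0. z \<in> ball (0::complex) pi"
    by (rule eventually_nhds_in_open) auto
  ultimately show ?thesis
  proof eventually_elim
    case (elim z)
    define w where "w = exp z - 1"
    have w: "norm w < r" "norm w < 1 / 2 ^ q" using elim(1) by (auto simp: w_def s_def)
    have Ln: "Ln (1 + w) = z"
      using elim(2) abs_Im_le_cmod[of z] by (auto simp: w_def intro!: Ln_exp)
    have "(2 ^ q * (norm w)\<^sup>2 :: real) < 1"
    proof -
      have "2 ^ q * norm w < 1"
        using w(2) by (simp add: field_simps)
      then have "(2 ^ q * norm w) * norm w \<le> 1 * norm w"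
        by (intro mult_right_mono) auto
      also have "norm w < 1"
        using less_le_trans[OF w(2), of 1] by simp
      finally show ?thesis by (simp add: power2_eq_square)
    qed
    then have "summable (\<lambda>n. (2 ^ q * (norm w)\<^sup>2) ^ n)"
      by (intro summable_geometric) auto
    moreover have "(2::real) ^ (n * q) = (2 ^ q) ^ n" "((norm w)\<^sup>2) ^ n = (norm w ^ n)\<^sup>2" for n
      by (simp_all add: mult.commute flip: power_mult)
    ultimately have "(\<lambda>n. w ^ n / fact n) \<in> test_space q"
      by (simp add: test_space_def norm_divide norm_power power_divide power_mult_distrib)
    moreover have "(\<lambda>n. w ^ n / fact n * appell_C lam \<beta> n x) sums wick_exp lam \<beta> z x" for x
      using r(2)[OF w(1), of x] by (simp add: Ln mult_ac)
    ultimately have "test_coeff lam \<beta> (wick_exp lam \<beta> z) = (\<lambda>n. w ^ n / fact n)"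
      by (rule test_coeff_eqI[OF assms(2) q])
    then show ?case
      by (simp add: S_transform_def dual_pairing_def dual_coeff_dual_series[OF assms]
          eval_fps_def mult.commute flip: w_def)
  qed
qed

lemma germ0_eq_iff: "germ0 f = germ0 g \<longleftrightarrow> (\<forall>\<^sub>F z in nhds 0. f z = g z)"
proof
  assume "germ0 f = germ0 g"
  moreover have "f \<in> germ0 f" by (simp add: germ0_def)
  ultimately show "\<forall>\<^sub>F z in nhds 0. f z = g z" by (auto simp: germ0_def)
next
  assume fg: "\<forall>\<^sub>F z in nhds 0. f z = g z"
  show "germ0 f = germ0 g"
    unfolding germ0_def using fg by (auto elim: eventually_elim2)
qed

lemma wick_expectation_dual_series:
  assumes "lam > 0" "0 < \<beta>"
  shows "wick_expectation lam \<beta> (dual_series lam \<beta> (fps_nth F)) = fps_nth F 0"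
proof -
  have "wick_exp lam \<beta> 0 = (\<lambda>_. 1)"
    by (simp add: wick_exp_def fun_eq_iff)
  \<comment> \<open>An event in \<open>nhds 0\<close> includes the point \<open>0\<close>
    itself.\<close>
  moreover have "S_transform lam \<beta> (dual_series lam \<beta> (fps_nth F)) 0 = eval_fps F (exp 0 - 1)"
    using eventually_nhds_x_imp_x[OF S_transform_dual_series[OF assms]] by blast
  ultimately show ?thesis
    by (simp add: wick_expectation_def S_transform_def eval_fps_at_0)
qed

lemma S_map_dual_series:
  assumes "lam > 0" "0 < \<beta>"
  shows "S_map lam \<beta> (dual_series lam \<beta> (fps_nth F)) = germ0 (\<lambda>z. eval_fps F (exp z - 1))"
  unfolding S_map_def germ0_eq_iff
  using S_transform_dual_series[OF assms] by (rule eventually_mono) blast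

text \<open>In the coordinate \<open>w\<close>, equal germs mean equal sums near \<open>0\<close>,
  and these determine the power series.\<close>

lemma inj_on_S_map:
  assumes "lam > 0" "0 < \<beta>"
  shows "inj_on (S_map lam \<beta>) (distributions lam \<beta>)"
proof (rule inj_onI)
  fix \<Phi> \<Psi>
  assume "\<Phi> \<in> distributions lam \<beta>" "\<Psi> \<in> distributions lam \<beta>" and eq: "S_map lam \<beta> \<Phi> = S_map lam \<beta> \<Psi>"
  then obtain F G where F: "fps_conv_radius F > 0" "\<Phi> = dual_series lam \<beta> (fps_nth F)"
    and G: "fps_conv_radius G > 0" "\<Psi> = dual_series lam \<beta> (fps_nth G)"
    by (auto simp: distributions_iff)
  from eq have "\<forall>\<^sub>F w in nhds 0. eval_fps F w = eval_fps G w"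
    unfolding F(2) G(2) S_map_dual_series[OF assms] germ0_eq_iff
    by (subst (asm) eventually_exp_minus_1_iff)
  then have "F = G"
    using F(1) G(1) by (intro fps_expansion_unique_complex[of "eval_fps G"]) (auto simp: has_fps_expansion_def)
  then show "\<Phi> = \<Psi>" by (simp add: F G)
qed

text \<open>\<open>the_inv_into\<close> is unspecified off the range of \<open>S_map\<close>; the
  unique existence of a preimage shows that \<open>wick_apply\<close> is a genuine inverse
  image.\<close>

theorem theorem7p2:
  fixes lam \<beta> :: real
    and \<Phi> :: "complex poly \<Rightarrow> complex"
    and L :: "complex \<Rightarrow> complex"
  assumes "lam > 0" and "0 < \<beta>" and "\<beta> \<le> 1"
    and "\<Phi> \<in> distributions lam \<beta>"
    and "L analytic_on {wick_expectation lam \<beta> \<Phi>}"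
  shows "(\<exists>!\<Psi>. \<Psi> \<in> distributions lam \<beta> \<and>
            S_map lam \<beta> \<Psi> = germ0 (\<lambda>z. L (S_transform lam \<beta> \<Phi> z))) \<and>
         wick_apply lam \<beta> L \<Phi> \<in> distributions lam \<beta>"
proof -
  note pos = assms(1,2)
  obtain F where F: "fps_conv_radius F > 0" "\<Phi> = dual_series lam \<beta> (fps_nth F)"
    using assms(4) by (auto simp: distributions_iff)
  have "L analytic_on {eval_fps F 0}"
    using assms(5) by (simp add: F(2) wick_expectation_dual_series[OF pos] eval_fps_at_0)
  moreover have "eval_fps F analytic_on {0}"
    using has_fps_expansion_imp_analytic_0[OF eval_fps_has_fps_expansion[OF F(1)]] .
  ultimately have "(\<lambda>w. L (eval_fps F w)) analytic_on {0}"
    using analytic_on_compose[of "eval_fps F" "{0}" L] by (simp add: o_def)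
  \<comment> \<open>\<open>G\<close> expands \<open>L\<close> after \<open>F\<close> in the
    coordinate \<open>w\<close>; its positive radius of convergence puts its dual series into
    \<open>distributions\<close>.\<close>
  then obtain G where "(\<lambda>w. L (eval_fps F w)) has_fps_expansion G"
    using analytic_at_imp_has_fps_expansion_0 by blast
  then have G: "fps_conv_radius G > 0" "\<forall>\<^sub>F w in nhds 0. eval_fps G w = L (eval_fps F w)"
    by (auto simp: has_fps_expansion_def)
  define \<Psi> where "\<Psi> = dual_series lam \<beta> (fps_nth G)"
  have \<Psi>: "\<Psi> \<in> distributions lam \<beta>"
    using G(1) by (auto simp: distributions_iff \<Psi>_def)
  have S\<Psi>: "S_map lam \<beta> \<Psi> = germ0 (\<lambda>z. L (S_transform lam \<beta> \<Phi> z))"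
    unfolding \<Psi>_def S_map_dual_series[OF pos] germ0_eq_iff F(2)
    using eventually_exp_minus_1[OF G(2)] S_transform_dual_series[OF pos]
    by eventually_elim simp
  have "wick_apply lam \<beta> L \<Phi> = \<Psi>"
    unfolding wick_apply_def S_inverse_def S\<Psi>[symmetric]
    using inj_on_S_map[OF pos] \<Psi> by (rule the_inv_into_f_f)
  moreover have "X = \<Psi>" if "X \<in> distributions lam \<beta>" "S_map lam \<beta> X = S_map lam \<beta> \<Psi>" for X
    using inj_onD[OF inj_on_S_map[OF pos] that(2,1) \<Psi>] .
  ultimately show ?thesis
    using \<Psi> unfolding S\<Psi>[symmetric] by blast
qed

end
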